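(* Let $\mathcal{G}=(G_n)_{n\ge1}$ be an $\mathrm{Inc}$-invariant chain of graphs with stability index $\mathrm{ind}(\mathcal{G})=r$. Assume that $V(G_r)=[r]$ and that $(1,i),(j,r)\in E(G_r)$ for some $i,j\in[r]$. Let $\mu(G_n)$ denote the matching number of $G_n$, i.e. the maximum cardinality of a set of pairwise disjoint edges of $G_n$. Then $$\mu(G_n)=\left\lfloor\frac{n}{2}\right\rfloor\quad\text{for all }n\ge8r.$$
   Context: $\mathbb{N}$ is the set of positive integers and $[n]=\{1,\dots,n\}$. Graphs are simple and finite, with vertex set contained in $\mathbb{N}$ (possibly empty); an edge $\{i,j\}$ with $i<j$ is written $(i,j)$. $G\subseteq H$ means $V(G)\subseteq V(H)$ and $E(G)\subseteq E(H)$. $\mathrm{Inc}$ is the monoid of strictly increasing maps $\pi:\mathbb{N}\to\mathbb{N}$, and $\mathrm{Inc}_{n,m}=\{\pi\in\mathrm{Inc}\mid\pi(n)\le m\}$ for $n\le m$. For $\Gamma\subseteq\mathrm{Inc}$ and a graph $G$, $\Gamma(G)$ is the graph with vertex set $\bigcup_{\pi\in\Gamma}\pi(V(G))$ and edge set $\{(\pi(i),\pi(j))\mid \pi\in\Gamma,(i,j)\in E(G)\}$. An $\mathrm{Inc}$-invariant chain of graphs is a sequence $(G_n)_{n\ge1}$ of graphs with $V(G_n)\subseteq[n]$ and $\mathrm{Inc}_{n,m}(G_n)\subseteq G_m$ for all $m\ge n\ge1$. Every such chain stabilizes: there is $r\in\mathbb{N}$ with $\mathrm{Inc}_{n,m}(G_n)=G_m$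 for all $m\ge n\ge r$; the smallest such $r$ is the stability index $\mathrm{ind}(\mathcal{G})$. *)

theory Defs
  imports Complex_Main "HOL-Library.FuncSet" "HOL-Library.Disjoint_Sets" "HOL-Library.Infinite_Set"
begin

text \<open>The positive integers are the subset \<open>{1..}\<close> of \<^typ>\<open>nat\<close>. An edge, written
  \<open>(i,j)\<close> with \<open>i < j\<close> in the paper, is the two-element set \<open>{i,j}\<close>.\<close>

record ngraph =
  verts :: "nat set"
  edges :: "nat set set"

definition simple_graph :: "ngraph \<Rightarrow> bool" where
  "simple_graph G \<longleftrightarrow>
     finite (verts G) \<and> verts G \<subseteq> {1..} \<and> (\<forall>e\<in>edges G. e \<subseteq> verts G \<and> card e = 2)"

definition subgraph_of :: "ngraph \<Rightarrow> ngraph \<Rightarrow> bool" where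
  "subgraph_of G H \<longleftrightarrow> verts G \<subseteq> verts H \<and> edges G \<subseteq> edges H"

text \<open>The value of a map at \<open>0\<close> is left arbitrary; it is never used, since \<open>0\<close> is not a vertex.\<close>

definition Inc :: "(nat \<Rightarrow> nat) set" where
  "Inc = {\<pi> \<in> {1..} \<rightarrow> {1..}. strict_mono_on {1..} \<pi>}"

definition Inc_upto :: "nat \<Rightarrow> nat \<Rightarrow> (nat \<Rightarrow> nat) set" where
  "Inc_upto n m = {\<pi> \<in> Inc. \<pi> n \<le> m}"

definition graph_image :: "(nat \<Rightarrow> nat) set \<Rightarrow> ngraph \<Rightarrow> ngraph" where
  "graph_image \<Gamma> G =
     \<lparr>verts = (\<Union>\<pi>\<in>\<Gamma>. \<pi> ` verts G), edges = {\<pi> ` e | \<pi> e. \<pi> \<in> \<Gamma> \<and> e \<in> edges G}\<rparr>"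

text \<open>A sequence \<open>(G\<^sub>n)\<close> with \<open>n \<ge> 1\<close> is a function on \<^typ>\<open>nat\<close> whose value at \<open>0\<close> is ignored.\<close>

definition inc_chain :: "(nat \<Rightarrow> ngraph) \<Rightarrow> bool" where
  "inc_chain \<G> \<longleftrightarrow>
     (\<forall>n\<ge>1. simple_graph (\<G> n) \<and> verts (\<G> n) \<subseteq> {1..n}) \<and>
     (\<forall>n\<ge>1. \<forall>m\<ge>n. subgraph_of (graph_image (Inc_upto n m) (\<G> n)) (\<G> m))"

definition stable_from :: "(nat \<Rightarrow> ngraph) \<Rightarrow> nat \<Rightarrow> bool" where
  "stable_from \<G> r \<longleftrightarrow> (\<forall>n\<ge>r. \<forall>m\<ge>n. graph_image (Inc_upto n m) (\<G> n) = \<G> m)"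

text \<open>Well defined on every chain by \<open>inc_chain_stabilizes\<close> below.\<close>

definition stability_index :: "(nat \<Rightarrow> ngraph) \<Rightarrow> nat" where
  "stability_index \<G> = (LEAST r. r \<ge> 1 \<and> stable_from \<G> r)"

definition is_matching :: "ngraph \<Rightarrow> nat set set \<Rightarrow> bool" where
  "is_matching G M \<longleftrightarrow> M \<subseteq> edges G \<and> disjoint M"

definition matching_number :: "ngraph \<Rightarrow> nat" where
  "matching_number G = Max {card M | M. is_matching G M}"


lemma Inc_uptoI:
  assumes "\<And>x. x \<ge> 1 \<Longrightarrow> \<pi> x \<ge> 1" "\<And>x y. 1 \<le> x \<Longrightarrow> x < y \<Longrightarrow> \<pi> x < \<pi> y" "\<pi> n \<le> m"
  shows "\<pi> \<in> Inc_upto n m"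
  using assms by (auto simp: Inc_upto_def Inc_def strict_mono_on_def)

lemma Inc_uptoD:
  assumes "\<pi> \<in> Inc_upto n m"
  shows "\<And>x. x \<ge> 1 \<Longrightarrow> \<pi> x \<ge> 1" "\<And>x y. 1 \<le> x \<Longrightarrow> x < y \<Longrightarrow> \<pi> x < \<pi> y"
    "\<And>x y. 1 \<le> x \<Longrightarrow> x \<le> y \<Longrightarrow> \<pi> x \<le> \<pi> y" "\<pi> n \<le> m"
proof -
  show 1: "\<And>x y. 1 \<le> x \<Longrightarrow> x < y \<Longrightarrow> \<pi> x < \<pi> y"
    using assms by (auto simp: Inc_upto_def Inc_def strict_mono_on_def)
  show "\<And>x y. 1 \<le> x \<Longrightarrow> x \<le> y \<Longrightarrow> \<pi> x \<le> \<pi> y"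
    using 1 by (metis le_eq_less_or_eq)
qed (use assms in \<open>auto simp: Inc_upto_def Inc_def Pi_def\<close>)

lemma Inc_upto_factor:
  assumes \<pi>: "\<pi> \<in> Inc_upto k m" and k: "1 \<le> k" "k \<le> n" "n \<le> m"
  obtains \<sigma> \<tau> where "\<sigma> \<in> Inc_upto k n" "\<tau> \<in> Inc_upto n m" "\<And>x. x \<ge> 1 \<Longrightarrow> \<tau> (\<sigma> x) = \<pi> x"
proof -
  note D = Inc_uptoD[OF \<pi>]
  define \<sigma> where "\<sigma> x = min (\<pi> x) (x + (n - k))" for x
  define \<tau> where "\<tau> x = (if x \<le> n - k then x else max x (\<pi> (x - (n - k))))" for x
  show ?thesis
  proof
    show "\<sigma> \<in> Inc_upto k n"
    proof (rule Inc_uptoI)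
      show "\<sigma> k \<le> n" using k by (simp add: \<sigma>_def)
    next
      fix x :: nat assume "x \<ge> 1" then show "\<sigma> x \<ge> 1" using D(1)[of x] by (simp add: \<sigma>_def)
    next
      fix x y :: nat assume "1 \<le> x" "x < y"
      then show "\<sigma> x < \<sigma> y" using D(2)[of x y] by (simp add: \<sigma>_def min_def)
    qed
    show "\<tau> \<in> Inc_upto n m"
    proof (rule Inc_uptoI)
      show "\<tau> n \<le> m" using k D(4) by (auto simp: \<tau>_def)
    next
      fix x :: nat assume "x \<ge> 1" then show "\<tau> x \<ge> 1" by (auto simp: \<tau>_def max_def)
    next
      fix x y :: nat assume "1 \<le> x" "x < y"
      moreover have "\<pi> (x - (n - k)) < \<pi> (y - (n - k))" if "n - k < x"
        using D(2)[of "x - (n - k)" "y - (n - k)"] that \<open>x < y\<close> by linarith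
      ultimately show "\<tau> x < \<tau> y" by (auto simp: \<tau>_def max_def)
    qed
    fix x :: nat assume x: "x \<ge> 1"
    show "\<tau> (\<sigma> x) = \<pi> x"
    proof (cases "\<pi> x \<le> x + (n - k)")
      case True
      then show ?thesis using D(3)[of "\<pi> x - (n - k)" x] by (auto simp: \<tau>_def \<sigma>_def max_def)
    next
      case False
      then show ?thesis using x by (auto simp: \<tau>_def \<sigma>_def)
    qed
  qed
qed

lemma Inc_upto_trans:
  assumes "\<sigma> \<in> Inc_upto k n" "\<tau> \<in> Inc_upto n m" "1 \<le> k"
  shows "\<tau> \<circ> \<sigma> \<in> Inc_upto k m"
proof (rule Inc_uptoI)
  note D = Inc_uptoD[OF assms(1)] and E = Inc_uptoD[OF assms(2)]
  show "(\<tau> \<circ> \<sigma>) k \<le> m" using E(3)[of "\<sigma> k" n] D(1)[of k] D(4) E(4) assms(3) by simp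
qed (use Inc_uptoD(1,2)[OF assms(1)] Inc_uptoD(1,2)[OF assms(2)] in auto)

lemma Inc_upto_pair:
  assumes "1 \<le> i" "i \<le> j" "j \<le> k" "i' \<le> j'" "j' \<le> n"
    and "i \<le> i'" "j - i \<le> j' - i'" "k - j \<le> n - j'" "i = j \<longleftrightarrow> i' = j'"
  obtains \<pi> where "\<pi> \<in> Inc_upto k n" "\<pi> i = i'" "\<pi> j = j'"
proof
  let ?p = "\<lambda>x. if x < i then x else if x < j then x - i + i' else x - j + j'"
  show "?p \<in> Inc_upto k n" by (rule Inc_uptoI) (use assms in auto)
qed (use assms in auto)

lemma dickson3:
  fixes a b c :: "nat \<Rightarrow> nat"
  obtains p q where "p < q" "a p \<le> a q" "b p \<le> b q" "c p \<le> c q"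
proof -
  have sub: "\<exists>s::nat\<Rightarrow>nat. strict_mono s \<and> incseq (f \<circ> s)" for f :: "nat \<Rightarrow> nat"
  proof -
    obtain s :: "nat \<Rightarrow> nat" where s: "strict_mono s" "monoseq (\<lambda>n. f (s n))"
      using seq_monosub[of f] by auto
    show ?thesis
    proof (cases "incseq (\<lambda>n. f (s n))")
      case True
      then show ?thesis using s by (auto simp: comp_def)
    next
      case False
      then have dec: "decseq (\<lambda>n. f (s n))" using s by (simp add: monoseq_iff)
      obtain N where N: "\<And>n. f (s N) \<le> f (s n)"
        using ex_has_least_nat[of "\<lambda>_. True" 0 "\<lambda>n. f (s n)"] by auto
      then have "f (s (N + n)) = f (s N)" for n
        using dec by (intro antisym) (auto simp: decseq_def)
      moreover have "strict_mono (\<lambda>n. s (N + n))" using s(1) by (auto simp: strict_mono_def)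
      ultimately show ?thesis by (intro exI[of _ "\<lambda>n. s (N + n)"]) (auto simp: incseq_def)
    qed
  qed
  obtain s where s: "strict_mono s" "incseq (a \<circ> s)" using sub by blast
  obtain t where t: "strict_mono t" "incseq (b \<circ> s \<circ> t)" using sub[of "b \<circ> s"] by blast
  obtain u where u: "strict_mono u" "incseq (c \<circ> s \<circ> t \<circ> u)" using sub[of "c \<circ> s \<circ> t"] by blast
  have tu: "u 0 < u 1" "t (u 0) < t (u 1)" using t u by (auto simp: strict_mono_def)
  show ?thesis
  proof
    show "s (t (u 0)) < s (t (u 1))" using s tu by (auto simp: strict_mono_def)
  qed (use s(2) t(2) u(2) tu in \<open>auto simp: incseq_def\<close>)
qed

lemma pair_chain_stabilizes:
  fixes A :: "nat \<Rightarrow> (nat \<times> nat) set"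
  assumes bnd: "\<And>n i j. n \<ge> 1 \<Longrightarrow> (i,j) \<in> A n \<Longrightarrow> 1 \<le> i \<and> i \<le> j \<and> j \<le> n"
    and kind: "\<And>n n' i j i' j'. (i,j) \<in> A n \<Longrightarrow> (i',j') \<in> A n' \<Longrightarrow> i = j \<longleftrightarrow> i' = j'"
    and up: "\<And>k n i j \<pi>. 1 \<le> k \<Longrightarrow> k \<le> n \<Longrightarrow> (i,j) \<in> A k \<Longrightarrow> \<pi> \<in> Inc_upto k n \<Longrightarrow> (\<pi> i, \<pi> j) \<in> A n"
  obtains r where "\<And>n m i j. r \<le> n \<Longrightarrow> 1 \<le> n \<Longrightarrow> n \<le> m \<Longrightarrow> (i,j) \<in> A m \<Longrightarrow>
    \<exists>\<pi> i' j'. \<pi> \<in> Inc_upto n m \<and> (i',j') \<in> A n \<and> i = \<pi> i' \<and> j = \<pi> j'"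
proof -
  define gen where "gen k n i j \<longleftrightarrow> 
    (\<exists>\<pi> i' j'. \<pi> \<in> Inc_upto k n \<and> (i',j') \<in> A k \<and> i = \<pi> i' \<and> j = \<pi> j')" for k n i j
  define new where "new n i j \<longleftrightarrow> (i,j) \<in> A n \<and> (\<forall>k. 1 \<le> k \<longrightarrow> k < n \<longrightarrow> \<not> gen k n i j)" for n i j
  define N where "N = {n. n \<ge> 1 \<and> (\<exists>i j. new n i j)}"
  have "finite N"
  proof (rule ccontr)
    assume inf: "infinite N"
    define e where "e = Infinite_Set.enumerate N"
    have e: "e t \<ge> 1 \<and> (\<exists>i j. new (e t) i j)" for t
      using enumerate_in_set[OF inf, of t] by (auto simp: e_def N_def)
    then obtain i j where ij: "\<And>t. new (e t) (i t) (j t)" by metis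
    obtain p q where pq: "p < q" "i p \<le> i q" "j p - i p \<le> j q - i q" "e p - j p \<le> e q - j q"
      using dickson3[of i "\<lambda>t. j t - i t" "\<lambda>t. e t - j t"] by blast
    have lt: "e p < e q" using enumerate_mono[OF pq(1) inf] by (simp add: e_def)
    have mem: "(i t, j t) \<in> A (e t)" for t using ij by (simp add: new_def)
    have "1 \<le> i t \<and> i t \<le> j t \<and> j t \<le> e t" for t using bnd mem e by blast
    then obtain \<pi> where "\<pi> \<in> Inc_upto (e p) (e q)" "\<pi> (i p) = i q" "\<pi> (j p) = j q"
      using Inc_upto_pair[of "i p" "j p" "e p" "i q" "j q" "e q"] pq kind[OF mem mem] by metis
    then have "gen (e p) (e q) (i q) (j q)" using mem by (force simp: gen_def)
    then show False using ij[of q] lt e by (auto simp: new_def)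
  qed
  then obtain r where r: "\<And>n. n \<in> N \<Longrightarrow> n \<le> r" by (meson finite_nat_set_iff_bounded_le)
  show ?thesis
  proof
    fix n m i j assume n: "r \<le> n" "1 \<le> n" "n \<le> m" and A: "(i,j) \<in> A m"
    have "gen m m i j" unfolding gen_def
      using A by (intro exI[of _ "\<lambda>x. x"]) (auto intro!: Inc_uptoI)
    then have ex: "\<exists>k. 1 \<le> k \<and> k \<le> m \<and> gen k m i j" using n by (intro exI[of _ m]) auto
    define k where "k = (LEAST k. 1 \<le> k \<and> k \<le> m \<and> gen k m i j)"
    have k: "1 \<le> k" "k \<le> m" "gen k m i j" using LeastI_ex[OF ex] by (auto simp: k_def)
    obtain \<pi> i' j' where p: "\<pi> \<in> Inc_upto k m" "(i',j') \<in> A k" "i = \<pi> i'" "j = \<pi> j'"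
      using k(3) by (auto simp: gen_def)
    have "new k i' j'" unfolding new_def
    proof (intro conjI allI impI notI)
      fix l assume l: "1 \<le> l" "l < k" "gen l k i' j'"
      then obtain \<sigma> a b where s: "\<sigma> \<in> Inc_upto l k" "(a,b) \<in> A l" "i' = \<sigma> a" "j' = \<sigma> b"
        by (auto simp: gen_def)
      then have "gen l m i j" unfolding gen_def
        using Inc_upto_trans[OF s(1) p(1) l(1)] p by (intro exI[of _ "\<pi> \<circ> \<sigma>"]) auto
      then show False using not_less_Least[of l "\<lambda>k. 1 \<le> k \<and> k \<le> m \<and> gen k m i j"] l k
        by (auto simp: k_def)
    qed (rule p)
    then have "k \<le> n" using r[of k] k n by (force simp: N_def)
    then obtain \<sigma> \<tau> where st: "\<sigma> \<in> Inc_upto k n" "\<tau> \<in> Inc_upto n m"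
        "\<And>x. x \<ge> 1 \<Longrightarrow> \<tau> (\<sigma> x) = \<pi> x"
      using Inc_upto_factor[OF p(1) k(1) _ n(3)] by metis
    have "1 \<le> i'" "1 \<le> j'" using bnd[OF k(1) p(2)] by auto
    then show "\<exists>\<pi> i' j'. \<pi> \<in> Inc_upto n m \<and> (i',j') \<in> A n \<and> i = \<pi> i' \<and> j = \<pi> j'"
      using up[OF k(1) \<open>k \<le> n\<close> p(2) st(1)] st p by metis
  qed
qed

theorem inc_chain_stabilizes:
  assumes "inc_chain \<G>"
  shows "\<exists>r\<ge>1. stable_from \<G> r"
proof -
  have V: "i \<in> verts (\<G> n) \<Longrightarrow> 1 \<le> i \<and> i \<le> n" if "n \<ge> 1" for n i
    using assms that unfolding inc_chain_def by (metis atLeastAtMost_iff subsetD)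
  have E: "e \<subseteq> verts (\<G> n) \<and> card e = 2" if "n \<ge> 1" "e \<in> edges (\<G> n)" for n e
    using assms that by (auto simp: inc_chain_def simple_graph_def)
  have sub: "subgraph_of (graph_image (Inc_upto n m) (\<G> n)) (\<G> m)" if "n \<ge> 1" "n \<le> m" for n m
    using assms that by (auto simp: inc_chain_def)
  have upV: "\<pi> i \<in> verts (\<G> m)" if "1 \<le> n" "n \<le> m" "i \<in> verts (\<G> n)" "\<pi> \<in> Inc_upto n m" for n m i \<pi>
    using sub[OF that(1,2)] that(3,4) unfolding subgraph_of_def graph_image_def by simp blast
  have upE: "\<pi> ` e \<in> edges (\<G> m)" if "1 \<le> n" "n \<le> m" "e \<in> edges (\<G> n)" "\<pi> \<in> Inc_upto n m" for n m e \<pi>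
    using sub[OF that(1,2)] that(3,4) unfolding subgraph_of_def graph_image_def by simp blast
  define P where "P n = {(i,j). i = j \<and> i \<in> verts (\<G> n)}" for n
  define Q where "Q n = {(i,j). 1 \<le> i \<and> i < j \<and> {i,j} \<in> edges (\<G> n)}" for n
  obtain r1 where r1: "\<And>n m i j. r1 \<le> n \<Longrightarrow> 1 \<le> n \<Longrightarrow> n \<le> m \<Longrightarrow> (i,j) \<in> P m \<Longrightarrow>
      \<exists>\<pi> i' j'. \<pi> \<in> Inc_upto n m \<and> (i',j') \<in> P n \<and> i = \<pi> i' \<and> j = \<pi> j'"
  proof (rule pair_chain_stabilizes[of P])
    show "1 \<le> i \<and> i \<le> j \<and> j \<le> n" if "n \<ge> 1" "(i,j) \<in> P n" for n i j
      using V[of n i] that by (auto simp: P_def)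
    show "i = j \<longleftrightarrow> i' = j'" if "(i,j) \<in> P n" "(i',j') \<in> P n'" for n n' i j i' j'
      using that by (simp add: P_def)
    show "(\<pi> i, \<pi> j) \<in> P n" if "1 \<le> k" "k \<le> n" "(i,j) \<in> P k" "\<pi> \<in> Inc_upto k n" for k n i j \<pi>
      using upV[of k n i \<pi>] that by (auto simp: P_def)
  qed blast
  obtain r2 where r2: "\<And>n m i j. r2 \<le> n \<Longrightarrow> 1 \<le> n \<Longrightarrow> n \<le> m \<Longrightarrow> (i,j) \<in> Q m \<Longrightarrow>
      \<exists>\<pi> i' j'. \<pi> \<in> Inc_upto n m \<and> (i',j') \<in> Q n \<and> i = \<pi> i' \<and> j = \<pi> j'"
  proof (rule pair_chain_stabilizes[of Q])
    show "1 \<le> i \<and> i \<le> j \<and> j \<le> n" if "n \<ge> 1" "(i,j) \<in> Q n" for n i j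
      using E[of n "{i,j}"] V[of n j] that by (simp add: Q_def)
    show "i = j \<longleftrightarrow> i' = j'" if "(i,j) \<in> Q n" "(i',j') \<in> Q n'" for n n' i j i' j'
      using that by (simp add: Q_def)
    show "(\<pi> i, \<pi> j) \<in> Q n" if "1 \<le> k" "k \<le> n" "(i,j) \<in> Q k" "\<pi> \<in> Inc_upto k n" for k n i j \<pi>
      using upE[of k n "{i,j}" \<pi>] Inc_uptoD(1,2)[OF that(4), of i] that by (simp add: Q_def)
  qed blast
  have "graph_image (Inc_upto n m) (\<G> n) = \<G> m" if n: "Suc (r1 + r2) \<le> n" "n \<le> m" for n m
  proof -
    have n': "r1 \<le> n" "r2 \<le> n" "1 \<le> n" "1 \<le> m" using n by auto
    have "i \<in> verts (graph_image (Inc_upto n m) (\<G> n))" if i: "i \<in> verts (\<G> m)" for i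
    proof -
      have "(i,i) \<in> P m" using i by (simp add: P_def)
      then obtain \<pi> i' j' where "\<pi> \<in> Inc_upto n m" "(i',j') \<in> P n" "i = \<pi> i'"
        using r1[OF n'(1,3) n(2)] by blast
      then show ?thesis unfolding graph_image_def P_def by simp blast
    qed
    moreover have "e \<in> edges (graph_image (Inc_upto n m) (\<G> n))" if e: "e \<in> edges (\<G> m)" for e
    proof -
      obtain a b where ab: "e = {a,b}" "a \<noteq> b" using E[OF n'(4) e] by (meson card_2_iff)
      then obtain i j where ij: "e = {i,j}" "i < j"
        by (metis insert_commute linorder_neqE_nat)
      then have "1 \<le> i" using E[OF n'(4) e] V[OF n'(4), of i] by simp
      then have "(i,j) \<in> Q m" using ij e by (simp add: Q_def)
      then obtain \<pi> i' j' where p: "\<pi> \<in> Inc_upto n m" "(i',j') \<in> Q n" "i = \<pi> i'" "j = \<pi> j'"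
        using r2[OF n'(2,3) n(2)] by blast
      then have "e = \<pi> ` {i',j'}" "{i',j'} \<in> edges (\<G> n)" using ij by (simp_all add: Q_def)
      then show ?thesis unfolding graph_image_def using p(1) by simp blast
    qed
    ultimately show ?thesis using sub[OF n'(3) n(2)]
      by (intro ngraph.equality) (auto simp: subgraph_of_def)
  qed
  then show ?thesis unfolding stable_from_def by (intro exI[of _ "Suc (r1 + r2)"]) auto
qed

end

theory Submission
  imports Defs
begin

text \<open>
  A matching of a graph on at most \<open>n\<close> vertices has at most \<open>n div 2\<close> edges, so it is enough to
  exhibit one with \<open>h = n div 2\<close> edges. The shift by \<open>h\<close> provides it: the pairs \<open>{k, k + h}\<close> with
  \<open>1 \<le> k \<le> h\<close> are disjoint, and each of them is an edge of \<open>\<G> n\<close>.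

  The reason for the last claim is that an increasing map moves an edge \<open>{a, b}\<close> of \<open>\<G> r\<close> to every
  position that does not shrink any of the three gaps: the one before \<open>a\<close>, the one between \<open>a\<close>
  and \<open>b\<close>, and the one between \<open>b\<close> and the end of the vertex range
  (\<open>inc_chain_edge_shift\<close>). Both given edges have an inner gap of at most \<open>r - 1 \<le> h\<close>. The edge at
  the vertex \<open>1\<close> demands nothing on the left, and so it reaches \<open>{k, k + h}\<close> whenever \<open>k + h\<close> leaves
  enough room on the right; the edge at the vertex \<open>r\<close> demands nothing on the right, and so it
  reaches \<open>{k, k + h}\<close> whenever \<open>k\<close> leaves enough room on the left. As \<open>h\<close> is about half of \<open>n\<close>, a
  small \<open>k\<close> comes with a \<open>k + h\<close> far from \<open>n\<close>, so one of the two always works.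
\<close>

lemma inc_chain_edge_shift:
  assumes "inc_chain \<G>" and "{a, b} \<in> edges (\<G> r)"
    and "1 \<le> a" "a < b" "b \<le> r"
    and "a \<le> a'" "b - a \<le> b' - a'" "b' \<le> n" "r - b \<le> n - b'"
  shows "{a', b'} \<in> edges (\<G> n)"
proof -
  have "1 \<le> r" "r \<le> n"
    using assms(3-9) by linarith+
  obtain \<pi> where \<pi>: "\<pi> \<in> Inc_upto r n" "\<pi> a = a'" "\<pi> b = b'"
  proof (rule Inc_upto_pair[of a b r a' b' n])
    show "a = b \<longleftrightarrow> a' = b'" "a' \<le> b'"
      using assms(4,7) by linarith+
  qed (use assms(3-9) in auto)
  have "subgraph_of (graph_image (Inc_upto r n) (\<G> r)) (\<G> n)"
    using assms(1) \<open>1 \<le> r\<close> \<open>r \<le> n\<close> unfolding inc_chain_def by blast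
  moreover have "\<pi> ` {a, b} \<in> edges (graph_image (Inc_upto r n) (\<G> r))"
    using \<pi>(1) assms(2) unfolding graph_image_def by simp blast
  ultimately show ?thesis
    using \<pi>(2,3) unfolding subgraph_of_def by auto
qed

lemma matching_card_le:
  assumes "simple_graph G" and "is_matching G M"
  shows "2 * card M \<le> card (verts G)"
proof -
  have sub: "\<Union>M \<subseteq> verts G" and two: "\<And>e. e \<in> M \<Longrightarrow> card e = 2"
    using assms by (auto simp: simple_graph_def is_matching_def)
  have fin: "finite (verts G)"
    using assms by (simp add: simple_graph_def)
  have "card (\<Union>M) = (\<Sum>e\<in>M. card e)"
  proof (rule card_Union_disjoint)
    show "pairwise disjnt M"
      using assms by (auto simp: is_matching_def disjoint_def pairwise_def disjnt_def)
    show "finite e" if "e \<in> M" for e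
      using two[OF that] by (simp add: card_ge_0_finite)
  qed
  also have "\<dots> = 2 * card M"
    using two by simp
  finally show ?thesis
    using card_mono[OF fin sub] by simp
qed

lemma matching_number_eqI:
  assumes "is_matching G M" and "\<And>M'. is_matching G M' \<Longrightarrow> card M' \<le> card M"
  shows "matching_number G = card M"
  unfolding matching_number_def
proof (rule Max_eqI)
  have "{card M' |M'. is_matching G M'} \<subseteq> {..card M}"
    using assms(2) by auto
  then show "finite {card M' |M'. is_matching G M'}"
    by (rule finite_subset) simp
qed (use assms in auto)

lemma shift_matching:
  fixes h :: nat
  shows "disjoint ((\<lambda>k. {k, k + h}) ` {1..h})" and "card ((\<lambda>k. {k, k + h}) ` {1..h}) = h"
proof -
  show "disjoint ((\<lambda>k. {k, k + h}) ` {1..h})"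
    by (auto simp: disjoint_def)
  have "inj_on (\<lambda>k. {k, k + h}) {1..h}"
    by (auto simp: inj_on_def doubleton_eq_iff)
  then show "card ((\<lambda>k. {k, k + h}) ` {1..h}) = h"
    by (simp add: card_image)
qed

text \<open>
  The case split at \<open>k \<ge> j\<close> is the choice between the two given edges. For \<open>k < j\<close> the edge at the
  vertex \<open>1\<close> has to do, and the right gap that it demands is available since \<open>k + h\<close> and \<open>r - i\<close>
  together stay below \<open>h + 2 * r \<le> n\<close>.
\<close>

lemma half_shift_edge:
  assumes "inc_chain \<G>"
    and "1 < i" "i \<le> r" "{1, i} \<in> edges (\<G> r)"
    and "1 \<le> j" "j < r" "{j, r} \<in> edges (\<G> r)"
    and "4 * r \<le> n" and k: "k \<in> {1..n div 2}"
  shows "{k, k + n div 2} \<in> edges (\<G> n)"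
proof (cases "j \<le> k")
  case True
  show ?thesis
    by (rule inc_chain_edge_shift[OF assms(1,7)]) (use assms True in auto)
next
  case False
  show ?thesis
    by (rule inc_chain_edge_shift[OF assms(1,4)]) (use assms False in auto)
qed

theorem theorem7p1:
  fixes \<G> :: "nat \<Rightarrow> ngraph" and r i j :: nat
  assumes "inc_chain \<G>"
    and "stability_index \<G> = r"
    and "verts (\<G> r) = {1..r}"
    and "i \<in> {1..r}" and "{1, i} \<in> edges (\<G> r)"
    and "j \<in> {1..r}" and "{j, r} \<in> edges (\<G> r)"
  shows "\<forall>n\<ge>8 * r. matching_number (\<G> n) = n div 2"
proof (intro allI impI)
  fix n assume n: "8 * r \<le> n"
  have r: "1 \<le> r"
    using assms(4) by simp
  have graph: "simple_graph (\<G> m)" "verts (\<G> m) \<subseteq> {1..m}" if "1 \<le> m" for m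
    using assms(1) that by (auto simp: inc_chain_def)
  have "card {1, i} = 2" "card {j, r} = 2"
    using graph(1)[OF r] assms(5,7) by (auto simp: simple_graph_def)
  then have "i \<noteq> 1" "j \<noteq> r"
    by auto
  then have ij: "1 < i" "i \<le> r" "1 \<le> j" "j < r"
    using assms(4,6) by auto
  define M where "M = (\<lambda>k. {k, k + n div 2}) ` {1..n div 2}"
  have "M \<subseteq> edges (\<G> n)"
    using half_shift_edge[OF assms(1) ij(1,2) assms(5) ij(3,4) assms(7)] n
    by (auto simp: M_def)
  then have M: "is_matching (\<G> n) M" "card M = n div 2"
    using shift_matching[of "n div 2"] by (auto simp: is_matching_def M_def)
  moreover have "card M' \<le> n div 2" if "is_matching (\<G> n) M'" for M'
  proof -
    have "1 \<le> n"
      using r n by simp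
    then have "2 * card M' \<le> n"
      using matching_card_le[OF graph(1) that] card_mono[OF _ graph(2), of n] by simp
    then show ?thesis
      by simp
  qed
  ultimately show "matching_number (\<G> n) = n div 2"
    using matching_number_eqI[of "\<G> n" M] by simp
qed

end
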